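(* Let $\mathcal{M},\mathcal{N}$ be structures (in possibly different languages) and let $\tau\colon M\to N$ be a map. The following are equivalent. (1) $\tau$ extends to a Tarski system embedding $\mathcal{S}(\mathcal{M})\hookrightarrow\mathcal{S}(\mathcal{N})$. (2) $\tau$ is a trace embedding $\mathcal{M}\hookrightarrow\mathcal{N}$.
   Context: "Definable" means first order definable with parameters. A trace embedding $\mathcal{M}\hookrightarrow\mathcal{N}$ is a map $\tau\colon M\to N$ such that for every $m\ge 1$ and every $\mathcal{M}$-definable $X\subseteq M^m$ there is an $\mathcal{N}$-definable $Y\subseteq N^m$ with $X=\{(a_1,\dots,a_m)\in M^m : (\tau(a_1),\dots,\tau(a_m))\in Y\}$. A Tarski system $\mathcal{S}$ is a set $S$ together with a family $\mathcal{S}_n$ of subsets of $S^n$ for each $n\ge 1$ such that for all $1\le n<m$: (i) $\mathcal{S}_n$ is a boolean algebra of subsets of $S^n$; (ii) $\{a\}\in\mathcal{S}_1$ for each $a\in S$; (iii) $\{(a_1,a_2)\in S^2 : a_1=a_2\}\in\mathcal{S}_2$; (iv) if $\pi\colon S^m\to S^n$ is a coordinate projection then $\pi(X)\in\mathcal{S}_n$ for $X\in\mathcal{S}_m$ and $\pi^{-1}(X)\in\mathcal{S}_m$ for $X\in\mathcal{S}_n$. For a structure $\mathcal{M}$, $\mathcal{S}(\mathcal{M})$ is the Tarski system on the set $M$ whose $n$-th family consists of all $\mathcal{M}$-definable subsets of $M^n$. An embedding $\mathcal{S}\hookrightarrow\mathcal{U}$ of Tarski systems consists of an injection $\tau\colon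 S\hookrightarrow U$ together with an injection $\tau_n\colon\mathcal{S}_n\hookrightarrow\mathcal{U}_n$ for each $n\ge 1$ such that for all $X\in\mathcal{S}_n$ and $\alpha_1,\dots,\alpha_n\in S$: $(\alpha_1,\dots,\alpha_n)\in X\Longleftrightarrow(\tau(\alpha_1),\dots,\tau(\alpha_n))\in\tau_n(X)$. *)

theory Defs
  imports "HOL-Analysis.Sigma_Algebra" "HOL-Library.NList"
begin

section \<open>First-order structures and definable sets\<close>

text \<open>
  The Cartesian power \<open>A\<^sup>n\<close> is rendered by the library set \<open>nlists n A\<close> of lists over \<open>A\<close> of
  length \<open>n\<close>.  A language comes with explicit sets of symbols, so that languages without function
  symbols or without relation symbols are covered.  Constants are nullary function symbols.
\<close>

record ('f, 'r) language =
  Funs :: "'f set"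
  Rels :: "'r set"
  far :: "'f \<Rightarrow> nat"
  rar :: "'r \<Rightarrow> nat"

record ('f, 'r, 'a) struct =
  Univ :: "'a set"
  fint :: "'f \<Rightarrow> 'a list \<Rightarrow> 'a"
  rint :: "'r \<Rightarrow> 'a list set"

text \<open>The universe may be empty.\<close>

locale fo_structure =
  fixes L :: "('f, 'r) language" and M :: "('f, 'r, 'a) struct"
  assumes fint_closed: "f \<in> Funs L \<Longrightarrow> fint M f \<in> nlists (far L f) (Univ M) \<rightarrow> Univ M"
    and rint_subset: "r \<in> Rels L \<Longrightarrow> rint M r \<subseteq> nlists (rar L r) (Univ M)"

text \<open>Variables are de Bruijn indices: \<open>Exists\<close> binds index 0 and shifts the others.\<close>

datatype 'f tm = Var nat | Fn 'f "'f tm list"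

datatype ('f, 'r) fm =
    Bot
  | Eq "'f tm" "'f tm"
  | Rel 'r "'f tm list"
  | Neg "('f, 'r) fm"
  | Conj "('f, 'r) fm" "('f, 'r) fm"
  | Exists "('f, 'r) fm"

text \<open>
  \<open>wf_tm L k t\<close> and \<open>wf_fm L k \<phi>\<close>: \<open>t\<close> is an \<open>L\<close>-term, \<open>\<phi>\<close> an \<open>L\<close>-formula, and all free
  variables are below \<open>k\<close>.
\<close>

primrec wf_tm :: "('f, 'r) language \<Rightarrow> nat \<Rightarrow> 'f tm \<Rightarrow> bool" where
  "wf_tm L k (Var i) \<longleftrightarrow> i < k"
| "wf_tm L k (Fn f ts) \<longleftrightarrow> f \<in> Funs L \<and> length ts = far L f \<and> list_all (wf_tm L k) ts"

primrec wf_fm :: "('f, 'r) language \<Rightarrow> nat \<Rightarrow> ('f, 'r) fm \<Rightarrow> bool" where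
  "wf_fm L k Bot \<longleftrightarrow> True"
| "wf_fm L k (Eq s t) \<longleftrightarrow> wf_tm L k s \<and> wf_tm L k t"
| "wf_fm L k (Rel r ts) \<longleftrightarrow> r \<in> Rels L \<and> length ts = rar L r \<and> list_all (wf_tm L k) ts"
| "wf_fm L k (Neg \<phi>) \<longleftrightarrow> wf_fm L k \<phi>"
| "wf_fm L k (Conj \<phi> \<psi>) \<longleftrightarrow> wf_fm L k \<phi> \<and> wf_fm L k \<psi>"
| "wf_fm L k (Exists \<phi>) \<longleftrightarrow> wf_fm L (Suc k) \<phi>"

primrec eval_tm :: "('f, 'r, 'a) struct \<Rightarrow> 'a list \<Rightarrow> 'f tm \<Rightarrow> 'a" where
  "eval_tm M e (Var i) = e ! i"
| "eval_tm M e (Fn f ts) = fint M f (map (eval_tm M e) ts)"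

primrec sat :: "('f, 'r, 'a) struct \<Rightarrow> 'a list \<Rightarrow> ('f, 'r) fm \<Rightarrow> bool" where
  "sat M e Bot \<longleftrightarrow> False"
| "sat M e (Eq s t) \<longleftrightarrow> eval_tm M e s = eval_tm M e t"
| "sat M e (Rel r ts) \<longleftrightarrow> map (eval_tm M e) ts \<in> rint M r"
| "sat M e (Neg \<phi>) \<longleftrightarrow> \<not> sat M e \<phi>"
| "sat M e (Conj \<phi> \<psi>) \<longleftrightarrow> sat M e \<phi> \<and> sat M e \<psi>"
| "sat M e (Exists \<phi>) \<longleftrightarrow> (\<exists>a\<in>Univ M. sat M (a # e) \<phi>)"

text \<open>Definability of a subset of \<open>M\<^sup>n\<close>; the list \<open>ps\<close> holds the parameters.\<close>

definition definable ::
  "('f, 'r) language \<Rightarrow> ('f, 'r, 'a) struct \<Rightarrow> nat \<Rightarrow> 'a list set \<Rightarrow> bool" where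
  "definable L M n X \<longleftrightarrow>
     (\<exists>\<phi> ps. set ps \<subseteq> Univ M \<and> wf_fm L (n + length ps) \<phi> \<and>
        X = {xs \<in> nlists n (Univ M). sat M (xs @ ps) \<phi>})"

definition trace_embedding ::
  "('f, 'r) language \<Rightarrow> ('f, 'r, 'a) struct \<Rightarrow> ('g, 's) language \<Rightarrow> ('g, 's, 'b) struct \<Rightarrow>
   ('a \<Rightarrow> 'b) \<Rightarrow> bool" where
  "trace_embedding L M K N \<tau> \<longleftrightarrow>
     \<tau> \<in> Univ M \<rightarrow> Univ N \<and>
     (\<forall>m\<ge>1. \<forall>X. definable L M m X \<longrightarrow>
        (\<exists>Y. definable K N m Y \<and> X = {xs \<in> nlists m (Univ M). map \<tau> xs \<in> Y}))"


section \<open>Tarski systems\<close>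

text \<open>Only the families with index \<open>n \<ge> 1\<close> are meaningful.\<close>

record 'a tsys =
  Points :: "'a set"
  Fam :: "nat \<Rightarrow> 'a list set set"

text \<open>
  A coordinate projection \<open>S\<^sup>m \<rightarrow> S\<^sup>n\<close> is given by the set \<open>I\<close> of the \<open>n\<close> retained coordinates
  (numbered from 0); the library function \<open>nths\<close> keeps them in their original order.  Permutations of
  coordinates need not be included: closure under them follows from these axioms and the diagonal.
\<close>

locale tarski_system =
  fixes S :: "'a tsys"
  assumes boolean_algebra: "n \<ge> 1 \<Longrightarrow> algebra (nlists n (Points S)) (Fam S n)"
    and singleton: "a \<in> Points S \<Longrightarrow> {[a]} \<in> Fam S 1"
    and diagonal: "{[a, b] | a b. a \<in> Points S \<and> b \<in> Points S \<and> a = b} \<in> Fam S 2"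
    and projection:
      "\<lbrakk>1 \<le> n; n < m; I \<subseteq> {..<m}; card I = n; X \<in> Fam S m\<rbrakk>
        \<Longrightarrow> (\<lambda>xs. nths xs I) ` X \<in> Fam S n"
    and inverse_projection:
      "\<lbrakk>1 \<le> n; n < m; I \<subseteq> {..<m}; card I = n; X \<in> Fam S n\<rbrakk>
        \<Longrightarrow> {xs \<in> nlists m (Points S). nths xs I \<in> X} \<in> Fam S m"

locale tarski_embedding = dom: tarski_system S + cod: tarski_system U
  for S :: "'a tsys" and U :: "'b tsys" +
  fixes \<tau> :: "'a \<Rightarrow> 'b" and T :: "nat \<Rightarrow> 'a list set \<Rightarrow> 'b list set"
  assumes map_points: "\<tau> \<in> Points S \<rightarrow> Points U"
    and inj_points: "inj_on \<tau> (Points S)"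
    and map_fam: "n \<ge> 1 \<Longrightarrow> T n \<in> Fam S n \<rightarrow> Fam U n"
    and inj_fam: "n \<ge> 1 \<Longrightarrow> inj_on (T n) (Fam S n)"
    and mem_iff: "\<lbrakk>n \<ge> 1; X \<in> Fam S n; xs \<in> nlists n (Points S)\<rbrakk>
        \<Longrightarrow> xs \<in> X \<longleftrightarrow> map \<tau> xs \<in> T n X"

definition tsys_of :: "('f, 'r) language \<Rightarrow> ('f, 'r, 'a) struct \<Rightarrow> 'a tsys" where
  "tsys_of L M = \<lparr>Points = Univ M, Fam = (\<lambda>n. {X. definable L M n X})\<rparr>"


section \<open>The definable sets of a structure form a Tarski system\<close>

primrec ren_tm :: "(nat \<Rightarrow> nat) \<Rightarrow> 'f tm \<Rightarrow> 'f tm" where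
  "ren_tm f (Var i) = Var (f i)"
| "ren_tm f (Fn g ts) = Fn g (map (ren_tm f) ts)"

primrec ren :: "(nat \<Rightarrow> nat) \<Rightarrow> ('f, 'r) fm \<Rightarrow> ('f, 'r) fm" where
  "ren f Bot = Bot"
| "ren f (Eq s t) = Eq (ren_tm f s) (ren_tm f t)"
| "ren f (Rel r ts) = Rel r (map (ren_tm f) ts)"
| "ren f (Neg \<phi>) = Neg (ren f \<phi>)"
| "ren f (Conj \<phi> \<psi>) = Conj (ren f \<phi>) (ren f \<psi>)"
| "ren f (Exists \<phi>) = Exists (ren (case_nat 0 (\<lambda>i. Suc (f i))) \<phi>)"

lemma wf_ren_tm: "wf_tm L k t \<Longrightarrow> \<forall>i<k. f i < k' \<Longrightarrow> wf_tm L k' (ren_tm f t)"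
  by (induction t) (auto simp: list_all_iff)

lemma wf_ren: "wf_fm L k \<phi> \<Longrightarrow> \<forall>i<k. f i < k' \<Longrightarrow> wf_fm L k' (ren f \<phi>)"
proof (induction \<phi> arbitrary: f k k')
  case (Exists \<phi>)
  then show ?case by (auto intro!: Exists.IH split: nat.split)
qed (auto simp: list_all_iff wf_ren_tm)

lemma eval_ren_tm:
  "wf_tm L k t \<Longrightarrow> \<forall>i<k. e ! i = e' ! f i \<Longrightarrow> eval_tm M e' (ren_tm f t) = eval_tm M e t"
proof (induction t)
  case (Fn g ts)
  then show ?case by (auto simp: list_all_iff intro!: arg_cong[where f = "fint M g"])
qed auto

lemma sat_ren:
  "wf_fm L k \<phi> \<Longrightarrow> \<forall>i<k. e ! i = e' ! f i \<Longrightarrow> sat M e' (ren f \<phi>) = sat M e \<phi>"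
proof (induction \<phi> arbitrary: f k e e')
  case (Eq s t)
  then show ?case using eval_ren_tm[of L k s e e' f M] eval_ren_tm[of L k t e e' f M] by simp
next
  case (Rel r ts)
  then have "map (eval_tm M e') (map (ren_tm f) ts) = map (eval_tm M e) ts"
    by (auto simp: list_all_iff eval_ren_tm)
  then show ?case by (simp only: ren.simps sat.simps)
next
  case (Exists \<phi>)
  have "sat M (a # e') (ren (case_nat 0 (\<lambda>i. Suc (f i))) \<phi>) = sat M (a # e) \<phi>" for a
    by (rule Exists.IH[of "Suc k"]) (use Exists.prems in \<open>auto split: nat.split simp: nth_Cons\<close>)
  then show ?case by simp
next
  case (Neg \<phi>)
  then show ?case by (metis ren.simps(4) sat.simps(4) wf_fm.simps(4))
next
  case (Conj \<phi> \<psi>)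
  then show ?case by (metis ren.simps(5) sat.simps(5) wf_fm.simps(5))
qed simp

lemma definableI:
  assumes "set ps \<subseteq> Univ M" "wf_fm L (n + length ps) \<phi>"
    "X \<subseteq> nlists n (Univ M)"
    "\<And>xs. xs \<in> nlists n (Univ M) \<Longrightarrow> xs \<in> X \<longleftrightarrow> sat M (xs @ ps) \<phi>"
  shows "definable L M n X"
  unfolding definable_def using assms by (intro exI[of _ \<phi>] exI[of _ ps]) auto

lemma definableE:
  assumes "definable L M n X"
  obtains ps \<phi> where "set ps \<subseteq> Univ M" "wf_fm L (n + length ps) \<phi>"
    "X \<subseteq> nlists n (Univ M)"
    "\<And>xs. xs \<in> nlists n (Univ M) \<Longrightarrow> xs \<in> X \<longleftrightarrow> sat M (xs @ ps) \<phi>"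
  using assms unfolding definable_def by blast

lemma definable_Diff:
  assumes "definable L M n X" "definable L M n Y"
  shows "definable L M n (X - Y)"
proof -
  from assms(1) obtain ps \<phi> where p: "set ps \<subseteq> Univ M" "wf_fm L (n + length ps) \<phi>"
    "X \<subseteq> nlists n (Univ M)"
    "\<And>xs. xs \<in> nlists n (Univ M) \<Longrightarrow> xs \<in> X \<longleftrightarrow> sat M (xs @ ps) \<phi>" by (rule definableE) blast
  from assms(2) obtain qs \<psi> where q: "set qs \<subseteq> Univ M" "wf_fm L (n + length qs) \<psi>"
    "\<And>xs. xs \<in> nlists n (Univ M) \<Longrightarrow> xs \<in> Y \<longleftrightarrow> sat M (xs @ qs) \<psi>" by (rule definableE) blast
  define g where "g i = (if i < n then i else i + length ps)" for i
  show ?thesis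
  proof (rule definableI[of "ps @ qs" _ _ _ "Conj (ren id \<phi>) (Neg (ren g \<psi>))"])
    show "wf_fm L (n + length (ps @ qs)) (Conj (ren id \<phi>) (Neg (ren g \<psi>)))"
      using p(2) q(2) by (auto intro!: wf_ren simp: g_def)
  next
    fix xs assume xs: "xs \<in> nlists n (Univ M)"
    then have l: "length xs = n" by simp
    have "sat M (xs @ ps @ qs) (ren id \<phi>) = sat M (xs @ ps) \<phi>"
      by (rule sat_ren[OF p(2)]) (auto simp: l nth_append)
    moreover have "sat M (xs @ ps @ qs) (ren g \<psi>) = sat M (xs @ qs) \<psi>"
      by (rule sat_ren[OF q(2)]) (auto simp: l nth_append g_def)
    ultimately show "xs \<in> X - Y \<longleftrightarrow> sat M (xs @ ps @ qs) (Conj (ren id \<phi>) (Neg (ren g \<psi>)))"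
      using p(4) q(3) xs by simp
  qed (use p q in auto)
qed

lemma definable_univ: "definable L M n (nlists n (Univ M))"
  by (rule definableI[of "[]" _ _ _ "Neg Bot"]) auto

lemma definable_subset: "definable L M n X \<Longrightarrow> X \<subseteq> nlists n (Univ M)"
  by (auto simp: definable_def)

lemma definable_algebra: "algebra (nlists n (Univ M)) {X. definable L M n X}"
proof (subst algebra_iff_Un, intro conjI ballI)
  let ?U = "nlists n (Univ M)"
  show "{X. definable L M n X} \<subseteq> Pow ?U" using definable_subset by blast
  show "{} \<in> {X. definable L M n X}"
    using definable_Diff[OF definable_univ definable_univ] by simp
  fix X assume X: "X \<in> {X. definable L M n X}"
  show "?U - X \<in> {X. definable L M n X}"
    using X by (simp add: definable_Diff definable_univ)
  fix Y assume Y: "Y \<in> {X. definable L M n X}"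
  have "X \<union> Y = ?U - (?U - X - Y)"
    using X Y by (auto dest!: definable_subset)
  also have "definable L M n \<dots>"
    using X Y by (intro definable_Diff definable_univ) auto
  finally show "X \<union> Y \<in> {X. definable L M n X}" by simp
qed

lemma nths_eq_map:
  "length xs = m \<Longrightarrow> nths xs I = map ((!) xs) (filter (\<lambda>i. i \<in> I) [0..<m])"
proof -
  assume "length xs = m"
  then have "zip xs [0..<m] = map (\<lambda>i. (xs ! i, i)) [0..<m]"
    by (intro nth_equalityI) auto
  then show ?thesis
    using \<open>length xs = m\<close> by (simp add: nths_def filter_map comp_def)
qed

primrec Exs :: "nat \<Rightarrow> ('f, 'r) fm \<Rightarrow> ('f, 'r) fm" where
  "Exs 0 \<phi> = \<phi>"
| "Exs (Suc m) \<phi> = Exists (Exs m \<phi>)"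

lemma wf_Exs: "wf_fm L k (Exs m \<phi>) = wf_fm L (m + k) \<phi>"
  by (induction m arbitrary: k) auto

lemma sat_Exs: "sat M e (Exs m \<phi>) \<longleftrightarrow> (\<exists>zs\<in>nlists m (Univ M). sat M (rev zs @ e) \<phi>)"
proof (induction m arbitrary: e)
  case (Suc m)
  have "sat M e (Exs (Suc m) \<phi>) \<longleftrightarrow>
      (\<exists>a\<in>Univ M. \<exists>zs\<in>nlists m (Univ M). sat M (rev (a # zs) @ e) \<phi>)"
    by (simp add: Suc.IH)
  also have "\<dots> \<longleftrightarrow> (\<exists>zs\<in>nlists (Suc m) (Univ M). sat M (rev zs @ e) \<phi>)"
    by (simp only: in_nlists_Suc_iff Bex_def) blast
  finally show ?case .
qed simp

definition Conjs :: "('f, 'r) fm list \<Rightarrow> ('f, 'r) fm" where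
  "Conjs \<phi>s = foldr Conj \<phi>s (Neg Bot)"

lemma wf_Conjs: "wf_fm L k (Conjs \<phi>s) \<longleftrightarrow> (\<forall>\<phi>\<in>set \<phi>s. wf_fm L k \<phi>)"
  by (induction \<phi>s) (auto simp: Conjs_def)

lemma sat_Conjs: "sat M e (Conjs \<phi>s) \<longleftrightarrow> (\<forall>\<phi>\<in>set \<phi>s. sat M e \<phi>)"
  by (induction \<phi>s) (auto simp: Conjs_def)

lemma length_coords:
  assumes "I \<subseteq> {..<m}" "card I = n"
  shows "length (filter (\<lambda>i. i \<in> I) [0..<m]) = n"
proof -
  have "set (filter (\<lambda>i. i \<in> I) [0..<m]) = I" using assms(1) by auto
  then show ?thesis using assms(2) distinct_card[of "filter (\<lambda>i. i \<in> I) [0..<m]"] by simp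
qed

lemma definable_vimage:
  assumes I: "I \<subseteq> {..<m}" "card I = n" and X: "definable L M n X"
  shows "definable L M m {xs \<in> nlists m (Univ M). nths xs I \<in> X}"
proof -
  from X obtain ps \<phi> where p: "set ps \<subseteq> Univ M" "wf_fm L (n + length ps) \<phi>"
    "\<And>xs. xs \<in> nlists n (Univ M) \<Longrightarrow> xs \<in> X \<longleftrightarrow> sat M (xs @ ps) \<phi>" by (rule definableE) blast
  define js where "js = filter (\<lambda>i. i \<in> I) [0..<m]"
  have lis: "length js = n" using length_coords[OF I] by (simp add: js_def)
  have "set js \<subseteq> {..<m}" by (auto simp: js_def)
  then have bnd: "js ! j < m" if "j < n" for j using \<open>set js \<subseteq> {..<m}\<close> nth_mem[of j js] that lis by (metis lessThan_iff subsetD)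
  define g where "g j = (if j < n then js ! j else j - n + m)" for j
  show ?thesis
  proof (rule definableI[of ps _ _ _ "ren g \<phi>"])
    show "wf_fm L (m + length ps) (ren g \<phi>)"
      by (rule wf_ren[OF p(2)]) (auto simp: g_def bnd trans_less_add1)
  next
    fix xs assume xs: "xs \<in> nlists m (Univ M)"
    then have l: "length xs = m" by simp
    have n: "nths xs I = map ((!) xs) js" by (simp add: nths_eq_map[OF l] js_def)
    have mem: "nths xs I \<in> nlists n (Univ M)"
      using nlistsE_set[OF xs]
      by (intro nlistsI order_trans[OF set_nths_subset]) (auto simp: n lis)
    have "sat M (xs @ ps) (ren g \<phi>) = sat M (nths xs I @ ps) \<phi>"
      by (rule sat_ren[OF p(2)]) (auto simp: l n lis nth_append g_def bnd)
    then show "xs \<in> {xs \<in> nlists m (Univ M). nths xs I \<in> X} \<longleftrightarrow> sat M (xs @ ps) (ren g \<phi>)"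
      using p(3)[OF mem] xs by simp
  qed (use p in auto)
qed

lemma definable_image:
  assumes I: "I \<subseteq> {..<m}" "card I = n" and X: "definable L M m X"
  shows "definable L M n ((\<lambda>xs. nths xs I) ` X)"
proof -
  from X obtain ps \<phi> where p: "set ps \<subseteq> Univ M" "wf_fm L (m + length ps) \<phi>"
    "X \<subseteq> nlists m (Univ M)"
    "\<And>xs. xs \<in> nlists m (Univ M) \<Longrightarrow> xs \<in> X \<longleftrightarrow> sat M (xs @ ps) \<phi>" by (rule definableE) blast
  define js where "js = filter (\<lambda>i. i \<in> I) [0..<m]"
  have lis: "length js = n" using length_coords[OF I] by (simp add: js_def)
  have "set js \<subseteq> {..<m}" by (auto simp: js_def)
  then have bnd: "js ! j < m" if "j < n" for j using \<open>set js \<subseteq> {..<m}\<close> nth_mem[of j js] that lis by (metis lessThan_iff subsetD)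
  define g where "g j = (if j < m then m - 1 - j else j + n)" for j
  define \<psi> where "\<psi> = Exs m (Conj (ren g \<phi>)
    (Conjs (map (\<lambda>j. Eq (Var (g (js ! j))) (Var (m + j))) [0..<n])))"
  have n: "nths xs I = map ((!) xs) js" if "length xs = m" for xs
    by (simp add: nths_eq_map[OF that] js_def)
  have mem: "nths xs I \<in> nlists n (Univ M)" if "xs \<in> nlists m (Univ M)" for xs
    using nlistsE_set[OF that]
    by (intro nlistsI order_trans[OF set_nths_subset]) (auto simp: n[OF nlistsE_length[OF that]] lis)
  show ?thesis
  proof (rule definableI[of ps _ _ _ \<psi>])
    have "wf_fm L (m + (n + length ps)) (ren g \<phi>)"
      by (rule wf_ren[OF p(2)]) (auto simp: g_def)
    moreover have "g (js ! j) < m + (n + length ps)" if "j < n" for j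
      using bnd[OF that] by (simp add: g_def)
    ultimately show "wf_fm L (n + length ps) \<psi>"
      by (auto simp: \<psi>_def wf_Exs wf_Conjs)
  next
    show "(\<lambda>xs. nths xs I) ` X \<subseteq> nlists n (Univ M)" using mem p(3) by blast
  next
    fix ys assume ys: "ys \<in> nlists n (Univ M)"
    then have l: "length ys = n" by simp
    have *: "sat M (rev zs @ ys @ ps) (Conj (ren g \<phi>)
        (Conjs (map (\<lambda>j. Eq (Var (g (js ! j))) (Var (m + j))) [0..<n])))
      \<longleftrightarrow> zs \<in> X \<and> nths zs I = ys" if zs: "zs \<in> nlists m (Univ M)" for zs
    proof -
      have lz: "length zs = m" using zs by simp
      have g: "(rev zs @ ys @ ps) ! g j = zs ! j" if "j < m" for j
        using that by (simp add: g_def nth_append lz rev_nth)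
      have "sat M (rev zs @ ys @ ps) (ren g \<phi>) = sat M (zs @ ps) \<phi>"
      proof (rule sat_ren[OF p(2)], intro allI impI)
        fix i assume "i < m + length ps"
        show "(zs @ ps) ! i = (rev zs @ ys @ ps) ! g i"
          by (cases "i < m") (auto simp: g, auto simp: g_def nth_append lz l)
      qed
      moreover have "nths zs I = ys \<longleftrightarrow> (\<forall>j<n. zs ! (js ! j) = ys ! j)"
        unfolding n[OF lz] list_eq_iff_nth_eq by (simp add: lis l)
      moreover have "(rev zs @ ys @ ps) ! (m + j) = ys ! j" if "j < n" for j
        using that by (simp add: nth_append lz l)
      ultimately show ?thesis
        using p(4)[OF zs] by (auto simp: sat_Conjs g bnd simp del: append_assoc)
    qed
    show "ys \<in> (\<lambda>xs. nths xs I) ` X \<longleftrightarrow> sat M (ys @ ps) \<psi>"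
      unfolding \<psi>_def sat_Exs using * p(3) by (auto simp del: sat.simps)
  qed (use p in auto)
qed

lemma tarski_system_tsys_of: "tarski_system (tsys_of L M)"
proof (rule tarski_system.intro)
  fix a assume "a \<in> Points (tsys_of L M)"
  then have a: "a \<in> Univ M" by (simp add: tsys_of_def)
  show "{[a]} \<in> Fam (tsys_of L M) 1"
    unfolding tsys_of_def using a
    by (auto intro!: definableI[of "[a]" _ _ _ "Eq (Var 0) (Var 1)"] nlistsI
        simp: in_nlists_Suc_iff)
next
  have "definable L M 2 {[a, b] | a b. a \<in> Univ M \<and> b \<in> Univ M \<and> a = b}"
    by (rule definableI[of "[]" _ _ _ "Eq (Var 0) (Var 1)"])
      (auto simp: in_nlists_Suc_iff numeral_2_eq_2)
  then show "{[a, b] | a b. a \<in> Points (tsys_of L M) \<and> b \<in> Points (tsys_of L M) \<and> a = b}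
      \<in> Fam (tsys_of L M) 2"
    by (simp add: tsys_of_def)
qed (simp_all add: tsys_of_def definable_algebra definable_image definable_vimage)

end

theory Submission
  imports Defs
begin

text \<open>
  A definable \<open>X\<close> is recovered from any \<open>Y\<close> with \<open>X = \<tau>\<^sup>-\<^sup>1(Y)\<close>, so choosing one such \<open>Y\<close> for each
  \<open>X\<close> gives injections between the families.  Injectivity of \<open>\<tau>\<close> itself is forced by the trace
  condition for the diagonal.
\<close>

lemma Points_tsys_of [simp]: "Points (tsys_of L M) = Univ M"
  and Fam_tsys_of [simp]: "Fam (tsys_of L M) n = {X. definable L M n X}"
  by (simp_all add: tsys_of_def)

lemma trace_embedding_inj_on:
  assumes "trace_embedding L M K N \<tau>"
  shows "inj_on \<tau> (Univ M)"
proof (rule inj_onI)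
  fix a b assume ab: "a \<in> Univ M" "b \<in> Univ M" "\<tau> a = \<tau> b"
  let ?D = "{[a, b] | a b. a \<in> Univ M \<and> b \<in> Univ M \<and> a = b}"
  have "definable L M 2 ?D"
    using tarski_system.diagonal[OF tarski_system_tsys_of, of L M] by simp
  then obtain Y where Y: "?D = {xs \<in> nlists 2 (Univ M). map \<tau> xs \<in> Y}"
    using assms unfolding trace_embedding_def by (meson one_le_numeral)
  have "[a, a] \<in> ?D" using ab by simp
  \<comment> \<open>By \<open>ab(3)\<close> the lists \<open>[a, b]\<close> and
    \<open>[a, a]\<close> have the same image under \<open>map \<tau>\<close>, so \<open>Y\<close>
    cannot separate them.\<close>
  then have "map \<tau> [a, b] \<in> Y" using ab(3) unfolding Y by simp
  then have "[a, b] \<in> ?D"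
    unfolding Y using ab by (simp add: in_nlists_Suc_iff numeral_2_eq_2)
  then show "a = b" by simp
qed

lemma trace_embedding_imp_tarski_embedding:
  assumes tr: "trace_embedding L M K N \<tau>"
  shows "\<exists>T. tarski_embedding (tsys_of L M) (tsys_of K N) \<tau> T"
proof -
  \<comment> \<open>The guard stands under the existential quantifier, so that some \<open>Y\<close>
    exists for every pair \<open>n\<close>, \<open>X\<close> and choice yields a total
    \<open>T\<close>. Its values at \<open>n = 0\<close> or at an undefinable \<open>X\<close> are
    arbitrary.\<close>
  have "\<forall>n X. \<exists>Y. n \<ge> 1 \<and> definable L M n X \<longrightarrow>
      definable K N n Y \<and> X = {xs \<in> nlists n (Univ M). map \<tau> xs \<in> Y}"
    using tr unfolding trace_embedding_def by blast
  then obtain T where T: "\<And>n X. n \<ge> 1 \<Longrightarrow> definable L M n X \<Longrightarrow> definable K N n (T n X)"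
    "\<And>n X. n \<ge> 1 \<Longrightarrow> definable L M n X \<Longrightarrow> X = {xs \<in> nlists n (Univ M). map \<tau> xs \<in> T n X}"
    by metis
  have "tarski_embedding (tsys_of L M) (tsys_of K N) \<tau> T"
  proof (intro tarski_embedding.intro tarski_embedding_axioms.intro tarski_system_tsys_of)
    show "\<tau> \<in> Points (tsys_of L M) \<rightarrow> Points (tsys_of K N)"
      using tr by (simp add: trace_embedding_def)
    show "inj_on \<tau> (Points (tsys_of L M))"
      using trace_embedding_inj_on[OF tr] by simp
  next
    fix n :: nat assume n: "n \<ge> 1"
    show "T n \<in> Fam (tsys_of L M) n \<rightarrow> Fam (tsys_of K N) n"
      using T(1)[OF n] by simp
    show "inj_on (T n) (Fam (tsys_of L M) n)"
    proof (rule inj_onI)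
      fix X Y assume "X \<in> Fam (tsys_of L M) n" "Y \<in> Fam (tsys_of L M) n" "T n X = T n Y"
      \<comment> \<open>Both sets are the preimage under \<open>map \<tau>\<close> of one and the
        same set \<open>T n X = T n Y\<close>.\<close>
      then show "X = Y" using T(2)[OF n, of X] T(2)[OF n, of Y] by simp
    qed
    fix X xs assume "X \<in> Fam (tsys_of L M) n" "xs \<in> nlists n (Points (tsys_of L M))"
    then show "xs \<in> X \<longleftrightarrow> map \<tau> xs \<in> T n X"
      using T(2)[OF n, of X] by auto
  qed
  then show ?thesis by blast
qed

lemma tarski_embedding_imp_trace_embedding:
  assumes "tarski_embedding (tsys_of L M) (tsys_of K N) \<tau> T"
  shows "trace_embedding L M K N \<tau>"
proof -
  interpret tarski_embedding "tsys_of L M" "tsys_of K N" \<tau> T by (rule assms)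
  show ?thesis unfolding trace_embedding_def
  proof (intro conjI allI impI)
    show "\<tau> \<in> Univ M \<rightarrow> Univ N" using map_points by simp
    fix m :: nat and X assume m: "m \<ge> 1" and X: "definable L M m X"
    \<comment> \<open>The image \<open>T m X\<close> under the given embedding is the witness for
      the trace condition at \<open>X\<close>.\<close>
    have "definable K N m (T m X)" using map_fam[OF m] X by auto
    \<comment> \<open>\<open>mem_iff\<close> compares memberships only for lists in
      \<open>nlists m (Univ M)\<close>; by \<open>definable_subset\<close> the set \<open>X\<close>
      has no other elements, which gives equality of sets.\<close>
    moreover have "X = {xs \<in> nlists m (Univ M). map \<tau> xs \<in> T m X}"
      using mem_iff[OF m, of X] X definable_subset[OF X] by auto
    ultimately show "\<exists>Y. definable K N m Y \<and> X = {xs \<in> nlists m (Univ M). map \<tau> xs \<in> Y}"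
      by blast
  qed
qed

theorem proposition1p12:
  fixes L :: "('f, 'r) language" and M :: "('f, 'r, 'a) struct"
    and K :: "('g, 's) language" and N :: "('g, 's, 'b) struct"
    and \<tau> :: "'a \<Rightarrow> 'b"
  assumes "fo_structure L M" and "fo_structure K N"
    and "\<tau> \<in> Univ M \<rightarrow> Univ N"
  shows "(\<exists>T. tarski_embedding (tsys_of L M) (tsys_of K N) \<tau> T)
     \<longleftrightarrow> trace_embedding L M K N \<tau>"
  using trace_embedding_imp_tarski_embedding tarski_embedding_imp_trace_embedding by blast

end
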